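(* Let $J$ and $X$ be solutions of the SDYM3 equation $D_{\bar y}(J^{-1}J_y)+D_z(J^{-1}J_z)=0$ and the PSDYM3 equation $X_{y\bar y}+X_{zz}+[X_z,X_{\bar y}]=0$, respectively, connected by $J^{-1}J_y=X_z$, $J^{-1}J_z=-X_{\bar y}$. The PSDYM3 recursion operator $\hat R=D_z^{-1}\hat A_y$ and the SDYM3 recursion operator $\hat T=J D_z^{-1}\hat A_yJ^{-1}=J\hat RJ^{-1}$ are $I$-equivalent; that is, $\hat R\Phi=I\{\hat TQ\}$ whenever $\Phi=I\{Q\}$, where $Q$ and $\Phi$ are symmetry characteristics of SDYM3 and PSDYM3, respectively.
   Context: The independent variables are $y,z,\bar y$ (complex, treated as three independent variables). $D_y,D_z,D_{\bar y}$ are the total derivatives, also denoted by subscripts; they commute and satisfy the Leibniz rule. $J$ is $SL(N,\mathbb{C})$-valued, $X$ is $sl(N,\mathbb{C})$-valued, and $[\cdot,\cdot]$ is the matrix commutator. An operator acts on the entire product to its right. The covariant derivative operators are $$\hat A_y=D_y+[J^{-1}J_y,\ \cdot\ ]=D_y+[X_z,\ \cdot\ ],\qquad \hat A_z=D_z+[J^{-1}J_z,\ \cdot\ ]=D_z-[X_{\bar y},\ \cdot\ ],$$ and $D_z^{-1}$ is formal integration in $z$ with $D_zD_z^{-1}=\mathrm{id}$. $Q$ is an SDYM3 symmetry characteristic if $(D_{\bar y}\hat A_y+D_z\hat A_z)(J^{-1}Q)=0$ on solutions. $\Phi$ is a PSDYM3 symmetry characteristic if $(D_{\bar y}\hat A_y+D_z\hat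 A_z)\Phi=0$ on solutions. A recursion operator for one of these equations is a linear operator mapping its symmetry characteristics to symmetry characteristics. The map $I$ from SDYM3 characteristics to PSDYM3 characteristics is $I\{Q\}=\hat RJ^{-1}Q$. When $\hat R$ is applied to a function $\phi$ satisfying $(D_{\bar y}\hat A_y+D_z\hat A_z)\phi=0$, $\hat R\phi$ denotes the common solution $\phi'$ of the consistent system $\phi'_z=\hat A_y\phi$, $\phi'_{\bar y}=-\hat A_z\phi$, with arbitrary additive terms ignored. Recursion operators $\hat P$ (for PSDYM3) and $\hat S$ (for SDYM3) are $I$-equivalent if $\hat P\Phi=I\{\hat SQ\}$ whenever $\Phi=I\{Q\}$. *)

theory Defs
  imports "HOL-Complex_Analysis.Complex_Analysis"
begin

text \<open>
  Points are triples \<open>(y, z, yb)\<close>, where \<open>yb\<close> is the variable usually written as the conjugate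
  of \<open>y\<close>, but treated as independent of it. All fields are evaluated along a given solution, so
  that the total derivatives become complex partial derivatives. Only the values of a field on the
  domain \<open>U\<close> matter: fields are compared pointwise on \<open>U\<close>.
\<close>

type_synonym point = "complex \<times> complex \<times> complex"
type_synonym 'n mfield = "point \<Rightarrow> complex^'n^'n"

definition D\<^sub>y :: "'n mfield \<Rightarrow> 'n::finite mfield" where
  "D\<^sub>y f = (\<lambda>(y, z, yb). \<chi> i j. deriv (\<lambda>t. f (t, z, yb) $ i $ j) y)"

definition D\<^sub>z :: "'n mfield \<Rightarrow> 'n::finite mfield" where
  "D\<^sub>z f = (\<lambda>(y, z, yb). \<chi> i j. deriv (\<lambda>t. f (y, t, yb) $ i $ j) z)"

definition D\<^sub>y\<^sub>b :: "'n mfield \<Rightarrow> 'n::finite mfield" where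
  "D\<^sub>y\<^sub>b f = (\<lambda>(y, z, yb). \<chi> i j. deriv (\<lambda>t. f (y, z, t) $ i $ j) yb)"

text \<open>
  Joint holomorphy in three variables, in Osgood's form: continuous, and holomorphic in each variable
  separately. On an open set this is complex differentiability in the sense of Frechet.
\<close>

definition holomorphic_field :: "point set \<Rightarrow> 'n::finite mfield \<Rightarrow> bool" where
  "holomorphic_field U f \<longleftrightarrow>
     continuous_on U f \<and>
     (\<forall>i j.
       (\<forall>z yb. (\<lambda>t. f (t, z, yb) $ i $ j) holomorphic_on {t. (t, z, yb) \<in> U}) \<and>
       (\<forall>y yb. (\<lambda>t. f (y, t, yb) $ i $ j) holomorphic_on {t. (y, t, yb) \<in> U}) \<and>
       (\<forall>y z. (\<lambda>t. f (y, z, t) $ i $ j) holomorphic_on {t. (y, z, t) \<in> U}))"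

definition commutator :: "'n mfield \<Rightarrow> 'n mfield \<Rightarrow> 'n::finite mfield" where
  "commutator f g = (\<lambda>p. f p ** g p - g p ** f p)"

definition inv_mult :: "'n mfield \<Rightarrow> 'n mfield \<Rightarrow> 'n::finite mfield" where
  "inv_mult J f = (\<lambda>p. matrix_inv (J p) ** f p)"

definition SDYM3_solution :: "point set \<Rightarrow> 'n::finite mfield \<Rightarrow> bool" where
  "SDYM3_solution U J \<longleftrightarrow>
     holomorphic_field U J \<and> (\<forall>p\<in>U. det (J p) = 1) \<and>
     (\<forall>p\<in>U. D\<^sub>y\<^sub>b (inv_mult J (D\<^sub>y J)) p + D\<^sub>z (inv_mult J (D\<^sub>z J)) p = 0)"

definition PSDYM3_solution :: "point set \<Rightarrow> 'n::finite mfield \<Rightarrow> bool" where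
  "PSDYM3_solution U X \<longleftrightarrow>
     holomorphic_field U X \<and> (\<forall>p\<in>U. trace (X p) = 0) \<and>
     (\<forall>p\<in>U. D\<^sub>y\<^sub>b (D\<^sub>y X) p + D\<^sub>z (D\<^sub>z X) p + commutator (D\<^sub>z X) (D\<^sub>y\<^sub>b X) p = 0)"

definition connected_by_Backlund :: "point set \<Rightarrow> 'n mfield \<Rightarrow> 'n::finite mfield \<Rightarrow> bool" where
  "connected_by_Backlund U J X \<longleftrightarrow>
     (\<forall>p\<in>U. inv_mult J (D\<^sub>y J) p = D\<^sub>z X p \<and> inv_mult J (D\<^sub>z J) p = - D\<^sub>y\<^sub>b X p)"

text \<open>
  The covariant derivatives are written for arbitrary potentials \<open>a\<close>, \<open>b\<close>, since they are used
  both with the potentials built from \<open>J\<close> and with those built from \<open>X\<close>.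
\<close>

definition cov_y :: "'n mfield \<Rightarrow> 'n mfield \<Rightarrow> 'n::finite mfield" where
  "cov_y a \<phi> = (\<lambda>p. D\<^sub>y \<phi> p + commutator a \<phi> p)"

definition cov_z :: "'n mfield \<Rightarrow> 'n mfield \<Rightarrow> 'n::finite mfield" where
  "cov_z b \<phi> = (\<lambda>p. D\<^sub>z \<phi> p + commutator b \<phi> p)"

definition AJ\<^sub>y :: "'n mfield \<Rightarrow> 'n mfield \<Rightarrow> 'n::finite mfield" where
  "AJ\<^sub>y J = cov_y (inv_mult J (D\<^sub>y J))"

definition AJ\<^sub>z :: "'n mfield \<Rightarrow> 'n mfield \<Rightarrow> 'n::finite mfield" where
  "AJ\<^sub>z J = cov_z (inv_mult J (D\<^sub>z J))"

definition AX\<^sub>y :: "'n mfield \<Rightarrow> 'n mfield \<Rightarrow> 'n::finite mfield" where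
  "AX\<^sub>y X = cov_y (D\<^sub>z X)"

definition AX\<^sub>z :: "'n mfield \<Rightarrow> 'n mfield \<Rightarrow> 'n::finite mfield" where
  "AX\<^sub>z X = cov_z (\<lambda>p. - D\<^sub>y\<^sub>b X p)"

definition SDYM3_characteristics :: "point set \<Rightarrow> 'n mfield \<Rightarrow> 'n::finite mfield set" where
  "SDYM3_characteristics U J =
     {Q. holomorphic_field U Q \<and>
         (\<forall>p\<in>U. D\<^sub>y\<^sub>b (AJ\<^sub>y J (inv_mult J Q)) p + D\<^sub>z (AJ\<^sub>z J (inv_mult J Q)) p = 0)}"

definition PSDYM3_characteristics :: "point set \<Rightarrow> 'n mfield \<Rightarrow> 'n::finite mfield set" where
  "PSDYM3_characteristics U X =
     {\<Phi>. holomorphic_field U \<Phi> \<and>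
         (\<forall>p\<in>U. D\<^sub>y\<^sub>b (AX\<^sub>y X \<Phi>) p + D\<^sub>z (AX\<^sub>z X \<Phi>) p = 0)}"

text \<open>
  Since fields are total functions, an operator on fields over \<open>U\<close> must respect equality on \<open>U\<close>.
  The matrix \<open>mat a\<close> is the scalar matrix of \<open>a\<close>.
\<close>

definition linear_operator_on ::
    "point set \<Rightarrow> 'n mfield set \<Rightarrow> ('n mfield \<Rightarrow> 'n::finite mfield) \<Rightarrow> bool" where
  "linear_operator_on U V A \<longleftrightarrow>
     (\<forall>f\<in>V. \<forall>g\<in>V. (\<forall>p\<in>U. f p = g p) \<longrightarrow> (\<forall>p\<in>U. A f p = A g p)) \<and>
     (\<forall>f\<in>V. \<forall>g\<in>V. \<forall>a b. \<forall>p\<in>U.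
        A (\<lambda>q. mat a ** f q + mat b ** g q) p = mat a ** A f p + mat b ** A g p)"

definition recursion_operator ::
    "point set \<Rightarrow> 'n mfield set \<Rightarrow> ('n mfield \<Rightarrow> 'n::finite mfield) \<Rightarrow> bool" where
  "recursion_operator U V A \<longleftrightarrow> linear_operator_on U V A \<and> (\<forall>f\<in>V. A f \<in> V)"

definition common_solution :: "point set \<Rightarrow> 'n mfield \<Rightarrow> 'n mfield \<Rightarrow> 'n::finite mfield \<Rightarrow> bool" where
  "common_solution U X \<phi> \<phi>' \<longleftrightarrow>
     holomorphic_field U \<phi>' \<and>
     (\<forall>p\<in>U. D\<^sub>z \<phi>' p = AX\<^sub>y X \<phi> p \<and> D\<^sub>y\<^sub>b \<phi>' p = - AX\<^sub>z X \<phi> p)"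

text \<open>
  The system determines \<open>\<phi>'\<close> only up to an additive term \<open>c\<close> with \<open>D\<^sub>z c = D\<^sub>y\<^sub>b c = 0\<close>. Here \<open>R\<close> is
  any linear choice of these terms: \<open>R = D\<^sub>z\<inverse> AX\<^sub>y\<close>, with the integration in \<open>z\<close> adjusted so as to
  satisfy the second equation as well. There is no single right inverse \<open>D\<^sub>z\<inverse>\<close> acting on arbitrary
  fields with this property, since fields \<open>\<phi>\<close> with equal \<open>AX\<^sub>y X \<phi>\<close> can have different \<open>AX\<^sub>z X \<phi>\<close>.
\<close>

definition is_Rhat ::
    "point set \<Rightarrow> 'n mfield \<Rightarrow> ('n mfield \<Rightarrow> 'n::finite mfield) \<Rightarrow> bool" where
  "is_Rhat U X R \<longleftrightarrow>
     linear_operator_on U (PSDYM3_characteristics U X) R \<and>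
     (\<forall>\<phi>\<in>PSDYM3_characteristics U X. common_solution U X \<phi> (R \<phi>))"

definition That ::
    "'n mfield \<Rightarrow> ('n mfield \<Rightarrow> 'n mfield) \<Rightarrow> 'n mfield \<Rightarrow> 'n::finite mfield" where
  "That J R Q = (\<lambda>p. J p ** R (inv_mult J Q) p)"

definition I_map ::
    "'n mfield \<Rightarrow> ('n mfield \<Rightarrow> 'n mfield) \<Rightarrow> 'n mfield \<Rightarrow> 'n::finite mfield" where
  "I_map J R Q = R (inv_mult J Q)"

definition I_equivalent ::
    "point set \<Rightarrow> 'n mfield \<Rightarrow> 'n mfield \<Rightarrow> ('n mfield \<Rightarrow> 'n mfield) \<Rightarrow>
     ('n mfield \<Rightarrow> 'n mfield) \<Rightarrow> ('n mfield \<Rightarrow> 'n::finite mfield) \<Rightarrow> bool" where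
  "I_equivalent U J X R P S \<longleftrightarrow>
     recursion_operator U (PSDYM3_characteristics U X) P \<and>
     recursion_operator U (SDYM3_characteristics U J) S \<and>
     (\<forall>Q\<in>SDYM3_characteristics U J. \<forall>\<Phi>\<in>PSDYM3_characteristics U X.
        (\<forall>p\<in>U. \<Phi> p = I_map J R Q p) \<longrightarrow> (\<forall>p\<in>U. P \<Phi> p = I_map J R (S Q) p))"

end

theory Submission
  imports Defs
begin

text \<open>
  Write \<open>a = X\<^sub>z\<close> and \<open>b = - X\<^sub>y\<^sub>b\<close>. The PSDYM3 equation says that the connection with potentials \<open>a\<close>, \<open>b\<close>
  is flat, that is, \<open>A\<^sub>y\<close> and \<open>A\<^sub>z\<close> commute. By the Leibniz rule and the symmetry of mixed partial
  derivatives, \<open>(D\<^sub>y\<^sub>b A\<^sub>y + D\<^sub>z A\<^sub>z) \<psi> = A\<^sub>y \<psi>\<^sub>y\<^sub>b + A\<^sub>z \<psi>\<^sub>z\<close>, and for \<open>\<psi>\<^sub>z = A\<^sub>y \<phi>\<close>, \<open>\<psi>\<^sub>y\<^sub>b = - A\<^sub>z \<phi>\<close> this is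
  the curvature applied to \<open>\<phi>\<close>, hence zero: \<open>R\<close> preserves PSDYM3 characteristics. Since \<open>Q\<close> is an SDYM3
  characteristic iff \<open>J\<inverse> Q\<close> is a PSDYM3 characteristic, and \<open>J\<inverse> (That J R Q) = R (J\<inverse> Q)\<close> on \<open>U\<close>,
  both sides of the equivalence are \<open>R (R (J\<inverse> Q))\<close>.

  The analytic input is that partial derivatives of separately holomorphic continuous functions are
  again of this kind and commute, which follows from Cauchy's integral formula by differentiation
  under the integral sign.
\<close>

unbundle no fps_syntax

subsection \<open>Derivatives in complex directions\<close>

text \<open>The direction is a map \<open>e\<close> from the complex line rather than a vector,
  because points carry only real scalar multiplication. One argument about \<open>e\<close> then
  serves all three coordinate axes.\<close>

definition dir_deriv :: "(complex \<Rightarrow> 'a::real_normed_vector) \<Rightarrow> ('a \<Rightarrow> complex) \<Rightarrow> 'a \<Rightarrow> complex" where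
  "dir_deriv e g p = deriv (\<lambda>t. g (p + e t)) 0"

definition dir_differentiable ::
    "'a::real_normed_vector set \<Rightarrow> (complex \<Rightarrow> 'a) \<Rightarrow> ('a \<Rightarrow> complex) \<Rightarrow> bool" where
  "dir_differentiable U e g \<longleftrightarrow> (\<forall>p\<in>U. (\<lambda>t. g (p + e t)) field_differentiable at 0)"

text \<open>Linearity gives \<open>p + e s + e t = p + e (t + s)\<close>, so differentiability at 0
  seen from the point \<open>p + e s\<close> is differentiability at \<open>s\<close> seen from
  \<open>p\<close>.\<close>

lemma dir_differentiable_has_field_derivative:
  assumes "bounded_linear e" "dir_differentiable U e g" "p + e s \<in> U"
  shows "((\<lambda>t. g (p + e t)) has_field_derivative dir_deriv e g (p + e s)) (at s)"
proof -
  interpret bounded_linear e by fact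
  have "((\<lambda>t. g (p + e s + e t)) has_field_derivative dir_deriv e g (p + e s)) (at 0)"
    using assms(2,3) unfolding dir_differentiable_def dir_deriv_def
    by (simp add: field_differentiable_derivI)
  then have "((\<lambda>t. g (p + e (t + s))) has_field_derivative dir_deriv e g (p + e s)) (at 0)"
    by (simp add: add ac_simps)
  then show ?thesis
    using DERIV_shift[of "\<lambda>t. g (p + e t)" _ 0 s] by simp
qed

section \<open>Cauchy's formula on a circle of fixed radius\<close>

abbreviation circle_point :: "real \<Rightarrow> real \<Rightarrow> complex" where
  "circle_point r t \<equiv> of_real r * exp (2 * of_real pi * \<i> * of_real t)"

lemma norm_circle_point: "0 \<le> r \<Longrightarrow> norm (circle_point r t) = r"
  by (simp add: norm_mult)

text \<open>Centring the circle at the point itself makes the kernel independent of the point.\<close>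

lemma dir_deriv_eq_integral:
  assumes e: "bounded_linear e" and g: "continuous_on U g" "dir_differentiable U e g"
    and r: "r > 0" and U: "\<And>t. norm t \<le> r \<Longrightarrow> p + e t \<in> U"
  shows "dir_deriv e g p =
    integral (cbox 0 1) (\<lambda>t. g (p + e (circle_point r t)) / circle_point r t)"
proof -
  interpret bounded_linear e by fact
  define f where "f = (\<lambda>t. g (p + e t))"
  have "continuous_on (cball 0 r) f"
    unfolding f_def
    by (rule continuous_on_compose2[OF g(1)]) (auto intro!: continuous_intros continuous_on simp: U)
  moreover have "f holomorphic_on ball 0 r"
    unfolding holomorphic_on_def f_def
    using dir_differentiable_has_field_derivative[OF e g(2)] U
    by (meson field_differentiable_def field_differentiable_at_within less_imp_le mem_ball_0)
  ultimately have "(f has_field_derivative (1 / (2 * of_real pi * \<i>) *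
      contour_integral (circlepath 0 r) (\<lambda>u. f u / (u - 0)^2))) (at 0)"
    using r by (intro Cauchy_derivative_integral_circlepath(2)) auto
  then have "dir_deriv e g p = 1 / (2 * of_real pi * \<i>) *
      contour_integral (circlepath 0 r) (\<lambda>u. f u / u^2)"
    unfolding dir_deriv_def f_def by (simp add: DERIV_imp_deriv)
  \<comment> \<open>The velocity of the circle is \<open>2 * of_real pi * \<i>\<close> times
    \<open>circle_point r t\<close>, so one factor of the squared denominator cancels.\<close>
  also have "contour_integral (circlepath 0 r) (\<lambda>u. f u / u^2) =
      integral {0..1} (\<lambda>t. (2 * of_real pi * \<i>) * (f (circle_point r t) / circle_point r t))"
    unfolding contour_integral_integral vector_derivative_circlepath
    using r by (intro integral_cong)
      (simp add: circlepath_def part_circlepath_def linepath_def power2_eq_square field_simps)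
  also have "1 / (2 * of_real pi * \<i>) * \<dots> = integral {0..1} (\<lambda>t. f (circle_point r t) / circle_point r t)"
    by (subst integral_mult_right) simp
  finally show ?thesis by (simp add: f_def)
qed

text \<open>The point is that one radius \<open>r\<close> serves all \<open>q\<close> near
  \<open>p\<close>: the circle of integration can stay fixed while its centre moves.\<close>

lemma directed_neighbourhood:
  fixes e :: "complex \<Rightarrow> 'a::real_normed_vector"
  assumes "bounded_linear e" "open U" "p \<in> U"
  obtains r \<delta> where "r > 0" "\<delta> > 0" "\<And>q t. q \<in> ball p \<delta> \<Longrightarrow> norm t \<le> r \<Longrightarrow> q + e t \<in> U"
proof -
  interpret bounded_linear e by fact
  obtain \<rho> where \<rho>: "\<rho> > 0" "ball p \<rho> \<subseteq> U"
    using assms openE by blast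
  obtain K where K: "K > 0" "\<And>t. norm (e t) \<le> norm t * K"
    using pos_bounded by blast
  show ?thesis
  proof
    \<comment> \<open>Half of \<open>\<rho>\<close> is allotted to the distance from
      \<open>p\<close> to \<open>q\<close>, the other half to \<open>e t\<close>, whose norm is
      controlled by \<open>K\<close>.\<close>
    show "\<rho> / (2 * K) > 0" "\<rho> / 2 > 0" using \<rho> K by auto
    fix q and t :: complex assume q: "q \<in> ball p (\<rho> / 2)" and t: "norm t \<le> \<rho> / (2 * K)"
    have "norm (e t) \<le> \<rho> / 2"
      using K(2)[of t] t K(1) by (simp add: field_simps)
    moreover have "dist p (q + e t) \<le> dist p q + norm (e t)"
      using dist_triangle[of p "q + e t" q] by (simp add: dist_norm)
    ultimately show "q + e t \<in> U" using q \<rho> by auto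
  qed
qed

text \<open>The map \<open>h\<close> lets the centre depend on a parameter: it is the identity when
  continuity in the point is wanted, and \<open>p + k s\<close> when differentiating along
  \<open>k\<close>.\<close>

lemma continuous_on_circle_integrand:
  assumes "continuous_on U g" "bounded_linear e" "r > 0"
    and "continuous_on S h" "\<And>x t. x \<in> S \<Longrightarrow> norm t \<le> r \<Longrightarrow> h x + e t \<in> U"
  shows "continuous_on (S \<times> cbox 0 1)
    (\<lambda>(x, t). g (h x + e (circle_point r t)) / circle_point r t)"
  unfolding split_beta
  using assms(3,5)
  by (intro continuous_intros continuous_on_compose2[OF assms(1)] continuous_on_compose2[OF assms(4)]
      bounded_linear.continuous_on[OF assms(2)]) (auto simp: norm_circle_point)

text \<open>Near each point the derivative is a Cauchy integral over a fixed circle, and such an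
  integral depends continuously on its centre.\<close>

lemma continuous_on_dir_deriv:
  fixes g :: "'a::real_normed_vector \<Rightarrow> complex"
  assumes "open U" "bounded_linear e" "continuous_on U g" "dir_differentiable U e g"
  shows "continuous_on U (dir_deriv e g)"
proof -
  have "isCont (dir_deriv e g) p" if p: "p \<in> U" for p
  proof -
    obtain r \<delta> where r: "r > 0" "\<delta> > 0"
      and U: "\<And>q t. q \<in> ball p \<delta> \<Longrightarrow> norm t \<le> r \<Longrightarrow> q + e t \<in> U"
      using directed_neighbourhood[OF assms(2,1) p] by metis
    have "continuous_on (ball p \<delta>)
        (\<lambda>q. integral (cbox 0 1) (\<lambda>t. g (q + e (circle_point r t)) / circle_point r t))"
      using r U
      by (intro integral_continuous_on_param
          continuous_on_circle_integrand[where h = "\<lambda>x. x" and U = U] assms) auto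
    then have "continuous_on (ball p \<delta>) (dir_deriv e g)"
      by (rule continuous_on_eq) (use dir_deriv_eq_integral[OF assms(2-4) r(1)] U in auto)
    then show ?thesis using r by (simp add: continuous_on_eq_continuous_at)
  qed
  then show ?thesis by (simp add: continuous_at_imp_continuous_on)
qed

text \<open>Differentiating the Cauchy integral for \<open>dir_deriv e g\<close> along
  \<open>k\<close> under the integral sign yields the Cauchy integral of
  \<open>dir_deriv k g\<close>. This proves differentiability; if \<open>dir_deriv k g\<close> is
  itself differentiable along \<open>e\<close>, that integral is its derivative along
  \<open>e\<close>, so the order can be exchanged.\<close>

lemma dir_deriv_dir_deriv:
  fixes g :: "'a::real_normed_vector \<Rightarrow> complex"
  assumes U: "open U" and e: "bounded_linear e" and k: "bounded_linear k"
    and g: "continuous_on U g" "dir_differentiable U e g" "dir_differentiable U k g"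
  shows dir_differentiable_dir_deriv: "dir_differentiable U k (dir_deriv e g)"
    and dir_deriv_swap_if: "\<lbrakk>dir_differentiable U e (dir_deriv k g); p \<in> U\<rbrakk> \<Longrightarrow>
        dir_deriv k (dir_deriv e g) p = dir_deriv e (dir_deriv k g) p"
proof -
  interpret k: bounded_linear k by fact
  \<comment> \<open>The radius is exported together with the formula because the exchange of
    derivatives applies Cauchy's formula on the same circle again.\<close>
  have *: "\<exists>r>0. (\<forall>t. norm t \<le> r \<longrightarrow> p + e t \<in> U) \<and>
      ((\<lambda>s. dir_deriv e g (p + k s)) has_field_derivative
        integral (cbox 0 1) (\<lambda>t. dir_deriv k g (p + e (circle_point r t)) / circle_point r t)) (at 0)"
    if p: "p \<in> U" for p
  proof -
    obtain r \<delta> where r: "r > 0" "\<delta> > 0"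
      and rU: "\<And>q t. q \<in> ball p \<delta> \<Longrightarrow> norm t \<le> r \<Longrightarrow> q + e t \<in> U"
      using directed_neighbourhood[OF e U p] by metis
    obtain \<sigma> where \<sigma>: "\<sigma> > 0" "\<And>s. norm s \<le> \<sigma> \<Longrightarrow> p + k s \<in> ball p \<delta>"
      using directed_neighbourhood[OF k open_ball, of p p \<delta>] r(2) centre_in_ball by metis
    let ?B = "ball 0 \<sigma> :: complex set"
    have B: "p + k s \<in> ball p \<delta>" if "s \<in> ?B" for s
      using \<sigma>(2)[of s] that by simp
    have kc: "continuous_on ?B (\<lambda>s. p + k s)"
      by (intro continuous_intros k.continuous_on)
    have cont: "continuous_on (?B \<times> cbox 0 1)
        (\<lambda>(s, t). f (p + k s + e (circle_point r t)) / circle_point r t)"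
      if "continuous_on U f" for f :: "'a \<Rightarrow> complex"
      using B rU by (intro continuous_on_circle_integrand[where U = U] that e r kc) auto
    \<comment> \<open>The Leibniz rule works within a convex parameter set, here the disc
      \<open>?B\<close>; as the disc is open, the restriction is dropped afterwards.\<close>
    have "((\<lambda>s. integral (cbox 0 1) (\<lambda>t. g (p + k s + e (circle_point r t)) / circle_point r t))
        has_field_derivative integral (cbox 0 1)
          (\<lambda>t. dir_deriv k g (p + k 0 + e (circle_point r t)) / circle_point r t)) (at 0 within ?B)"
    proof (rule leibniz_rule_field_derivative)
      fix s t assume s: "s \<in> ?B" and "t \<in> cbox (0::real) 1"
      have "((\<lambda>s. g (p + e (circle_point r t) + k s)) has_field_derivative
          dir_deriv k g (p + e (circle_point r t) + k s)) (at s)"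
        using rU[OF B[OF s], of "circle_point r t"] r
        by (intro dir_differentiable_has_field_derivative[OF k g(3)])
          (simp add: norm_circle_point add_ac)
      then show "((\<lambda>s. g (p + k s + e (circle_point r t)) / circle_point r t) has_field_derivative
          dir_deriv k g (p + k s + e (circle_point r t)) / circle_point r t) (at s within ?B)"
        by - (rule DERIV_cdivide, rule has_field_derivative_at_within, simp add: add_ac)
    next
      fix s assume s: "s \<in> ?B"
      have "continuous_on (cbox 0 1)
          (\<lambda>t. (\<lambda>(s, t). g (p + k s + e (circle_point r t)) / circle_point r t) (s, t))"
        by (rule continuous_on_compose2[OF cont[OF g(1)]]) (use s in \<open>auto intro!: continuous_intros\<close>)
      then show "(\<lambda>t. g (p + k s + e (circle_point r t)) / circle_point r t) integrable_on cbox 0 1"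
        by (intro integrable_continuous) simp
    qed (use cont[OF continuous_on_dir_deriv[OF U k g(1,3)]] \<sigma> in auto)
    then have "((\<lambda>s. dir_deriv e g (p + k s)) has_field_derivative integral (cbox 0 1)
          (\<lambda>t. dir_deriv k g (p + e (circle_point r t)) / circle_point r t)) (at 0 within ?B)"
      unfolding k.zero add_0_right
      by (rule has_field_derivative_transform_within[OF _ \<sigma>(1)])
        (use dir_deriv_eq_integral[OF e g(1,2) r(1)] rU B \<sigma> in auto)
    then have "((\<lambda>s. dir_deriv e g (p + k s)) has_field_derivative integral (cbox 0 1)
          (\<lambda>t. dir_deriv k g (p + e (circle_point r t)) / circle_point r t)) (at 0)"
      using \<sigma>(1) by (simp add: at_within_open[of 0 ?B])
    then show ?thesis using r rU[of p] by auto
  qed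
  show "dir_differentiable U k (dir_deriv e g)"
    unfolding dir_differentiable_def field_differentiable_def using * by blast
  assume d: "dir_differentiable U e (dir_deriv k g)" and p: "p \<in> U"
  obtain r where r: "r > 0" "\<And>t. norm t \<le> r \<Longrightarrow> p + e t \<in> U"
    and D: "((\<lambda>s. dir_deriv e g (p + k s)) has_field_derivative
        integral (cbox 0 1) (\<lambda>t. dir_deriv k g (p + e (circle_point r t)) / circle_point r t)) (at 0)"
    using *[OF p] by blast
  have "dir_deriv k (dir_deriv e g) p =
      integral (cbox 0 1) (\<lambda>t. dir_deriv k g (p + e (circle_point r t)) / circle_point r t)"
    unfolding dir_deriv_def[of k "dir_deriv e g"] by (rule DERIV_imp_deriv[OF D])
  also have "\<dots> = dir_deriv e (dir_deriv k g) p"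
    using dir_deriv_eq_integral[OF e continuous_on_dir_deriv[OF U k g(1,3)] d r] by simp
  finally show "dir_deriv k (dir_deriv e g) p = dir_deriv e (dir_deriv k g) p" .
qed

text \<open>The differentiability still assumed in \<open>dir_deriv_swap_if\<close> is the other
  half of the same lemma with \<open>e\<close> and \<open>k\<close> exchanged.\<close>

lemma dir_deriv_swap:
  assumes "open U" "bounded_linear e" "bounded_linear k"
    and "continuous_on U g" "dir_differentiable U e g" "dir_differentiable U k g" "p \<in> U"
  shows "dir_deriv k (dir_deriv e g) p = dir_deriv e (dir_deriv k g) p"
  by (intro dir_deriv_swap_if[of U] dir_differentiable_dir_deriv assms)

subsection \<open>Holomorphic matrix fields\<close>

definition partial :: "(complex \<Rightarrow> point) \<Rightarrow> 'n mfield \<Rightarrow> 'n::finite mfield" where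
  "partial e f = (\<lambda>p. \<chi> i j. dir_deriv e (\<lambda>q. f q $ i $ j) p)"

text \<open>A relation is used beside the function \<open>partial\<close> because the sum and
  product rules need the existence of the derivative, which a value of \<open>deriv\<close> does not
  record.\<close>

definition has_partial ::
    "(complex \<Rightarrow> point) \<Rightarrow> 'n mfield \<Rightarrow> complex^'n^'n::finite \<Rightarrow> point \<Rightarrow> bool" where
  "has_partial e f f' p \<longleftrightarrow>
     (\<forall>i j. ((\<lambda>t. f (p + e t) $ i $ j) has_field_derivative f' $ i $ j) (at 0))"

abbreviation "y_axis \<equiv> \<lambda>t::complex. (t, 0::complex, 0::complex)"
abbreviation "z_axis \<equiv> \<lambda>t::complex. (0::complex, t, 0::complex)"
abbreviation "yb_axis \<equiv> \<lambda>t::complex. (0::complex, 0::complex, t)"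

abbreviation axes :: "(complex \<Rightarrow> point) set" where
  "axes \<equiv> {y_axis, z_axis, yb_axis}"

lemma bounded_linear_axes: "e \<in> axes \<Longrightarrow> bounded_linear e"
  by (auto intro!: bounded_linear_intros)

lemma D_eq_partial:
  "D\<^sub>y = partial y_axis" "D\<^sub>z = partial z_axis" "D\<^sub>y\<^sub>b = partial yb_axis"
  by (auto simp: fun_eq_iff D\<^sub>y_def D\<^sub>z_def D\<^sub>y\<^sub>b_def partial_def dir_deriv_def vec_eq_iff
      deriv_shift_0' o_def)

lemma has_partial_imp_partial: "has_partial e f f' p \<Longrightarrow> partial e f p = f'"
  by (simp add: has_partial_def partial_def dir_deriv_def vec_eq_iff DERIV_imp_deriv)

lemma continuous_on_matrix_iff:
  fixes f :: "'a::topological_space \<Rightarrow> 'b::topological_space^'n::finite^'m::finite"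
  shows "continuous_on U f \<longleftrightarrow> (\<forall>i j. continuous_on U (\<lambda>p. f p $ i $ j))"
proof
  assume "\<forall>i j. continuous_on U (\<lambda>p. f p $ i $ j)"
  then have "continuous_on U (\<lambda>p. \<chi> i j. f p $ i $ j)"
    by (intro continuous_on_vec_lambda) auto
  then show "continuous_on U f" by simp
qed (auto intro: continuous_on_component)

text \<open>The slices of an open set along the axes are open, so holomorphy on a slice is
  differentiability at each of its points; a translation moves that point to 0.\<close>

lemma holomorphic_field_iff_entries:
  assumes U: "open U"
  shows "holomorphic_field U f \<longleftrightarrow> (\<forall>i j. continuous_on U (\<lambda>p. f p $ i $ j) \<and>
    (\<forall>e\<in>axes. dir_differentiable U e (\<lambda>p. f p $ i $ j)))"
proof -
  have shift: "(\<lambda>t. h (c + t)) field_differentiable at 0 \<longleftrightarrow> h field_differentiable at c"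
    for h and c :: complex
    using DERIV_shift[of h _ 0 c] by (simp add: field_differentiable_def add.commute)
  have open_vimage: "open {t. e t \<in> U}" if "continuous_on UNIV e" for e :: "complex \<Rightarrow> point"
    using open_vimage[OF U that] by (simp add: vimage_def)
  have slice: "(\<forall>z yb. (\<lambda>t. g (t, z, yb)) holomorphic_on {t. (t, z, yb) \<in> U}) \<longleftrightarrow>
        dir_differentiable U y_axis g"
      "(\<forall>y yb. (\<lambda>t. g (y, t, yb)) holomorphic_on {t. (y, t, yb) \<in> U}) \<longleftrightarrow>
        dir_differentiable U z_axis g"
      "(\<forall>y z. (\<lambda>t. g (y, z, t)) holomorphic_on {t. (y, z, t) \<in> U}) \<longleftrightarrow>
        dir_differentiable U yb_axis g" for g :: "point \<Rightarrow> complex"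
    by (auto simp: holomorphic_on_open open_vimage continuous_intros dir_differentiable_def
        field_differentiable_def[symmetric] shift[of "\<lambda>t. g (t, _, _)"]
        shift[of "\<lambda>t. g (_, t, _)"] shift[of "\<lambda>t. g (_, _, t)"])
  show ?thesis
    unfolding holomorphic_field_def slice[of "\<lambda>p. f p $ i $ j" for i j] continuous_on_matrix_iff
    by (auto simp: all_conj_distrib)
qed

lemma holomorphic_field_iff:
  fixes f :: "'n::finite mfield"
  assumes "open U"
  shows "holomorphic_field U f \<longleftrightarrow>
    continuous_on U f \<and> (\<forall>e\<in>axes. \<forall>p\<in>U. has_partial e f (partial e f p) p)"
proof -
  have swap: "(\<forall>i j. C i j \<and> (\<forall>e\<in>A. \<forall>p\<in>U. D i j e p)) \<longleftrightarrow>
      (\<forall>i j. C i j) \<and> (\<forall>e\<in>A. \<forall>p\<in>U. \<forall>i j. D i j e p)"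
    for C :: "'n \<Rightarrow> 'n \<Rightarrow> bool" and D and A :: "(complex \<Rightarrow> point) set"
    by blast
  show ?thesis
    unfolding holomorphic_field_iff_entries[OF assms] continuous_on_matrix_iff
      dir_differentiable_def has_partial_def partial_def dir_deriv_def vec_lambda_beta
      DERIV_deriv_iff_field_differentiable
    by (rule swap)
qed

lemma has_partial_partial:
  "\<lbrakk>open U; holomorphic_field U f; e \<in> axes; p \<in> U\<rbrakk> \<Longrightarrow> has_partial e f (partial e f p) p"
  using holomorphic_field_iff by blast

lemma holomorphic_fieldI:
  assumes "open U" "continuous_on U f"
    and "\<And>e p. e \<in> axes \<Longrightarrow> p \<in> U \<Longrightarrow> has_partial e f (f' e p) p"
  shows "holomorphic_field U f"
  unfolding holomorphic_field_iff[OF assms(1)]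
  using assms(2,3) has_partial_imp_partial by metis

text \<open>Continuity comes from the Cauchy integral, and differentiability along every axis from
  differentiation under it. Hence second derivatives of fields are available.\<close>

lemma holomorphic_field_partial:
  assumes U: "open U" and f: "holomorphic_field U f" and e: "e \<in> axes"
  shows "holomorphic_field U (partial e f)"
  using f continuous_on_dir_deriv[OF U bounded_linear_axes[OF e]]
    dir_differentiable_dir_deriv[OF U bounded_linear_axes[OF e]] e bounded_linear_axes
  unfolding holomorphic_field_iff_entries[OF U] partial_def vec_lambda_beta by blast

lemma partial_swap:
  assumes "open U" "holomorphic_field U f" "e \<in> axes" "k \<in> axes" "p \<in> U"
  shows "partial e (partial k f) p = partial k (partial e f) p"
  using assms dir_deriv_swap[OF assms(1) bounded_linear_axes bounded_linear_axes, of k e]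
  unfolding holomorphic_field_iff_entries[OF assms(1)] partial_def vec_eq_iff vec_lambda_beta
  by blast

section \<open>Locality of partial derivatives\<close>

lemma eventually_directed:
  assumes "open U" "e \<in> axes" "p \<in> U"
  shows "eventually (\<lambda>t. p + e t \<in> U) (nhds 0)"
proof -
  obtain r \<delta> where "r > 0" "\<delta> > 0" "\<And>q t. q \<in> ball p \<delta> \<Longrightarrow> norm t \<le> r \<Longrightarrow> q + e t \<in> U"
    using directed_neighbourhood[OF bounded_linear_axes[OF assms(2)] assms(1,3)] by metis
  then show ?thesis
    unfolding eventually_nhds_metric by (intro exI[of _ r]) auto
qed

text \<open>This permits differentiating equations between fields that are known only on
  \<open>U\<close>.\<close>

lemma has_partial_cong:
  assumes "open U" "e \<in> axes" "p \<in> U" "\<And>q. q \<in> U \<Longrightarrow> f q = g q" "has_partial e f f' p"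
  shows "has_partial e g f' p"
proof -
  have "eventually (\<lambda>t. f (p + e t) $ i $ j = g (p + e t) $ i $ j) (nhds 0)" for i j
    using eventually_directed[OF assms(1-3)] by eventually_elim (simp add: assms(4))
  from DERIV_cong_ev[OF refl this refl] show ?thesis
    using assms(5) unfolding has_partial_def by blast
qed

lemma partial_cong:
  assumes "open U" "e \<in> axes" "p \<in> U" "\<And>q. q \<in> U \<Longrightarrow> f q = g q"
  shows "partial e f p = partial e g p"
proof -
  have "eventually (\<lambda>t. f (p + e t) $ i $ j = g (p + e t) $ i $ j) (nhds 0)" for i j
    using eventually_directed[OF assms(1-3)] by eventually_elim (simp add: assms(4))
  then show ?thesis
    by (simp add: partial_def dir_deriv_def vec_eq_iff deriv_cong_ev)
qed

lemma holomorphic_field_cong: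
  assumes "open U" "\<And>q. q \<in> U \<Longrightarrow> f q = g q" "holomorphic_field U f"
  shows "holomorphic_field U g"
proof (rule holomorphic_fieldI[OF assms(1)])
  show "continuous_on U g"
    by (rule continuous_on_eq[of U f]) (use assms in \<open>auto simp: holomorphic_field_def\<close>)
  show "has_partial e g (partial e f p) p" if "e \<in> axes" "p \<in> U" for e p
    using has_partial_cong[OF assms(1) that assms(2) has_partial_partial[OF assms(1,3) that]] .
qed

section \<open>Leibniz rule and matrix algebra\<close>

lemma has_partial_add:
  "\<lbrakk>has_partial e f f' p; has_partial e g g' p\<rbrakk> \<Longrightarrow> has_partial e (\<lambda>q. f q + g q) (f' + g') p"
  by (simp add: has_partial_def DERIV_add)

lemma has_partial_minus: "has_partial e f f' p \<Longrightarrow> has_partial e (\<lambda>q. - f q) (- f') p"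
  by (simp add: has_partial_def DERIV_minus)

lemma has_partial_mult:
  assumes "e \<in> axes" "has_partial e f f' p" "has_partial e g g' p"
  shows "has_partial e (\<lambda>q. f q ** g q) (f' ** g p + f p ** g') p"
proof -
  \<comment> \<open>The product rule produces factors at \<open>p + e 0\<close>, which must become
    factors at \<open>p\<close>.\<close>
  have "e 0 = 0" using assms(1) by (auto simp: zero_prod_def)
  then have "((\<lambda>t. \<Sum>k\<in>UNIV. f (p + e t) $ i $ k * g (p + e t) $ k $ j) has_field_derivative
      (\<Sum>k\<in>UNIV. f' $ i $ k * g p $ k $ j + g' $ k $ j * f p $ i $ k)) (at 0)" for i j
    using assms(2,3) by (intro DERIV_sum) (auto intro!: derivative_eq_intros simp: has_partial_def)
  then show ?thesis
    by (simp add: has_partial_def matrix_matrix_mult_def sum.distrib mult.commute)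
qed

lemma matrix_add_rdistrib: "(B + C) ** A = B ** A + C ** (A :: 'a::semiring_1^'n^'n)"
  by (simp add: matrix_matrix_mult_def vec_eq_iff distrib_right sum.distrib)

lemma matrix_diff_ldistrib: "A ** (B - C) = A ** B - A ** (C :: 'a::ring_1^'n^'n)"
  by (simp add: matrix_matrix_mult_def vec_eq_iff right_diff_distrib sum_subtractf)

lemma matrix_diff_rdistrib: "(B - C) ** A = B ** A - C ** (A :: 'a::ring_1^'n^'n)"
  by (simp add: matrix_matrix_mult_def vec_eq_iff left_diff_distrib sum_subtractf)

lemma matrix_minus_left: "(- B) ** A = - (B ** (A :: 'a::ring_1^'n^'n))"
  by (simp add: matrix_matrix_mult_def vec_eq_iff sum_negf)

lemma matrix_minus_right: "A ** (- B) = - (A ** (B :: 'a::ring_1^'n^'n))"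
  by (simp add: matrix_matrix_mult_def vec_eq_iff sum_negf)

lemmas matrix_ring_simps = matrix_add_ldistrib matrix_add_rdistrib matrix_diff_ldistrib
  matrix_diff_rdistrib matrix_minus_left matrix_minus_right matrix_mul_assoc

lemma has_partial_commutator:
  assumes "e \<in> axes" "has_partial e f f' p" "has_partial e g g' p"
  shows "has_partial e (commutator f g)
    (f' ** g p - g p ** f' + (f p ** g' - g' ** f p)) p"
  using has_partial_add[OF has_partial_mult[OF assms] has_partial_minus[OF has_partial_mult[OF assms(1,3,2)]]]
  by (simp add: commutator_def algebra_simps)

lemma holomorphic_field_mult:
  assumes "open U" "holomorphic_field U f" "holomorphic_field U g"
  shows "holomorphic_field U (\<lambda>p. f p ** g p)"
proof (rule holomorphic_fieldI[OF assms(1)])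
  show "continuous_on U (\<lambda>p. f p ** g p)"
    using assms unfolding holomorphic_field_def
    by (subst continuous_on_matrix_iff) (auto simp: matrix_matrix_mult_def intro!: continuous_intros)
  show "has_partial e (\<lambda>p. f p ** g p) (partial e f p ** g p + f p ** partial e g p) p"
    if "e \<in> axes" "p \<in> U" for e p
    by (intro has_partial_mult has_partial_partial[of U] assms that)
qed

section \<open>Holomorphy of the inverse matrix\<close>

lemma matrix_inv_inverse:
  fixes A :: "'a::field^'n^'n"
  assumes "det A \<noteq> 0"
  shows "A ** matrix_inv A = mat 1" "matrix_inv A ** A = mat 1"
proof -
  have "A ** matrix_inv A = mat 1 \<and> matrix_inv A ** A = mat 1"
    using assms unfolding invertible_det_nz[symmetric] invertible_def matrix_inv_def
    by (rule someI_ex)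
  then show "A ** matrix_inv A = mat 1" "matrix_inv A ** A = mat 1" by auto
qed

text \<open>Column \<open>j\<close> of the inverse solves the linear system whose right-hand side is
  the \<open>j\<close>-th unit vector; Cramer's rule gives its entries.\<close>

lemma matrix_inv_component:
  fixes A :: "'a::field^'n^'n"
  assumes "det A \<noteq> 0"
  shows "matrix_inv A $ i $ j =
    det (\<chi> a b. if b = i then mat 1 $ a $ j else A $ a $ b) / det A"
proof -
  have "A *v (\<chi> k. matrix_inv A $ k $ j) = (\<chi> k. mat 1 $ k $ j)"
    by (simp add: matrix_inv_inverse(1)[OF assms, symmetric] matrix_vector_mult_def
        matrix_matrix_mult_def)
  then show ?thesis
    unfolding cramer[OF assms] by (subst (asm) vec_eq_iff) (simp cong: if_cong)
qed

text \<open>Since the determinant is 1, Cramer's rule makes each entry of the inverse a polynomial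
  in the entries of \<open>J\<close>.\<close>

lemma holomorphic_field_matrix_inv:
  fixes J :: "'n::finite mfield"
  assumes U: "open U" and J: "holomorphic_field U J" "\<And>p. p \<in> U \<Longrightarrow> det (J p) = 1"
  shows "holomorphic_field U (\<lambda>p. matrix_inv (J p))"
proof -
  \<comment> \<open>\<open>M i j\<close> is \<open>J\<close> with column \<open>i\<close> replaced
    by the \<open>j\<close>-th unit vector, so that \<open>K\<close> is the adjugate of
    \<open>J\<close>; each entry is a constant or an entry of \<open>J\<close>.\<close>
  define M where "M = (\<lambda>i j a b p. if b = i then mat 1 $ a $ j else J p $ a $ b)"
  define K where "K = (\<lambda>p. \<chi> i j. det (\<chi> a b. M i j a b p))"
  have M: "continuous_on U (M i j a b) \<and> (\<forall>e\<in>axes. dir_differentiable U e (M i j a b))" for i j a b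
  proof (cases "b = i")
    case True
    then show ?thesis by (simp add: M_def dir_differentiable_def)
  next
    case False
    then show ?thesis
      using J(1) unfolding holomorphic_field_iff_entries[OF U] by (simp add: M_def)
  qed
  have "holomorphic_field U K"
    unfolding holomorphic_field_iff_entries[OF U] K_def vec_lambda_beta det_def
  proof (intro allI conjI ballI)
    fix i j
    show "continuous_on U (\<lambda>p. \<Sum>\<sigma> | \<sigma> permutes UNIV.
        of_int (sign \<sigma>) * (\<Prod>k\<in>UNIV. M i j k (\<sigma> k) p))"
      using M by (intro continuous_on_sum continuous_on_mult continuous_on_const
          continuous_on_prod) auto
    fix e assume e: "e \<in> axes"
    show "dir_differentiable U e (\<lambda>p. \<Sum>\<sigma> | \<sigma> permutes UNIV.
        of_int (sign \<sigma>) * (\<Prod>k\<in>UNIV. M i j k (\<sigma> k) p))"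
      unfolding dir_differentiable_def
    proof (rule ballI)
      fix p assume p: "p \<in> U"
      have "dir_differentiable U e (M i j a b)" for a b
        by (rule bspec[OF conjunct2[OF M] e])
      then have "(\<lambda>t. M i j a b (p + e t)) field_differentiable at 0" for a b
        using p by (simp add: dir_differentiable_def)
      then have d: "((\<lambda>t. M i j a b (p + e t)) has_field_derivative
          deriv (\<lambda>t. M i j a b (p + e t)) 0) (at 0)" for a b
        by (rule field_differentiable_derivI)
      have "(\<lambda>t. \<Prod>k\<in>UNIV. M i j k (\<sigma> k) (p + e t)) field_differentiable at 0" for \<sigma>
        unfolding field_differentiable_def
        by (rule exI, rule has_field_derivative_prod[where f = "\<lambda>k t. M i j k (\<sigma> k) (p + e t)"], rule d)
      then show "(\<lambda>t. \<Sum>\<sigma> | \<sigma> permutes UNIV.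
          of_int (sign \<sigma>) * (\<Prod>k\<in>UNIV. M i j k (\<sigma> k) (p + e t))) field_differentiable at 0"
        by (intro field_differentiable_sum field_differentiable_mult field_differentiable_const)
    qed
  qed
  moreover have "K p = matrix_inv (J p)" if "p \<in> U" for p
    by (simp add: K_def M_def vec_eq_iff matrix_inv_component J(2)[OF that])
  ultimately show ?thesis
    by (rule holomorphic_field_cong[OF U, rotated])
qed

subsection \<open>Symmetry characteristics\<close>

lemma D_commute_holomorphic:
  assumes "open U" "holomorphic_field U f"
  shows "p \<in> U \<Longrightarrow> D\<^sub>y (D\<^sub>z f) p = D\<^sub>z (D\<^sub>y f) p" "p \<in> U \<Longrightarrow> D\<^sub>y\<^sub>b (D\<^sub>y f) p = D\<^sub>y (D\<^sub>y\<^sub>b f) p"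
    "p \<in> U \<Longrightarrow> D\<^sub>y\<^sub>b (D\<^sub>z f) p = D\<^sub>z (D\<^sub>y\<^sub>b f) p"
    "holomorphic_field U (D\<^sub>y f)" "holomorphic_field U (D\<^sub>z f)" "holomorphic_field U (D\<^sub>y\<^sub>b f)"
  unfolding D_eq_partial
  by (intro partial_swap[OF assms] holomorphic_field_partial[OF assms]; simp)+

text \<open>Facts 1 and 2 expand the two terms of the characteristic equation for
  \<open>\<psi>\<close>, 3 and 4 replace its second derivatives by means of the system, and 5 and 6
  express the derivatives of \<open>b\<close> through those of \<open>a\<close>.\<close>

lemma common_solution_PSDYM3_characteristic:
  fixes X :: "'n::finite mfield"
  assumes U: "open U" and X: "PSDYM3_solution U X"
    and \<phi>: "holomorphic_field U \<phi>" and \<psi>: "common_solution U X \<phi> \<psi>"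
  shows "\<psi> \<in> PSDYM3_characteristics U X"
proof -
  define a where "a = D\<^sub>z X"
  define b where "b = (\<lambda>p. - D\<^sub>y\<^sub>b X p)"
  have hX: "holomorphic_field U X" and h\<psi>: "holomorphic_field U \<psi>"
    using X \<psi> by (auto simp: PSDYM3_solution_def common_solution_def)
  have ha: "holomorphic_field U a"
    unfolding a_def by (rule D_commute_holomorphic[OF U hX])
  have b: "has_partial e b (- partial e (D\<^sub>y\<^sub>b X) p) p" if "e \<in> axes" "p \<in> U" for e p
    unfolding b_def by (intro has_partial_minus has_partial_partial[OF U] D_commute_holomorphic[OF U hX] that)
  have hb: "holomorphic_field U b"
    by (rule holomorphic_fieldI[OF U _ b])
      (use D_commute_holomorphic[OF U hX] in \<open>auto simp: b_def holomorphic_field_def intro!: continuous_intros\<close>)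
  note part = has_partial_partial[OF U]
  have cov: "has_partial e (\<lambda>q. f q + commutator c \<theta> q) (partial e f p +
      (partial e c p ** \<theta> p - \<theta> p ** partial e c p +
        (c p ** partial e \<theta> p - partial e \<theta> p ** c p))) p"
    if "holomorphic_field U f" "holomorphic_field U c" "holomorphic_field U \<theta>" "e \<in> axes" "p \<in> U"
    for e f c \<theta> p
    by (intro has_partial_add has_partial_commutator part that)
  have \<psi>z: "D\<^sub>z \<psi> p = D\<^sub>y \<phi> p + commutator a \<phi> p"
    and \<psi>b: "D\<^sub>y\<^sub>b \<psi> p = - (D\<^sub>z \<phi> p + commutator b \<phi> p)" if "p \<in> U" for p
    using \<psi> that by (auto simp: common_solution_def AX\<^sub>y_def AX\<^sub>z_def cov_y_def cov_z_def a_def b_def)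
  have "D\<^sub>y\<^sub>b (AX\<^sub>y X \<psi>) p + D\<^sub>z (AX\<^sub>z X \<psi>) p = 0" if p: "p \<in> U" for p
  proof -
    have 1: "D\<^sub>y\<^sub>b (AX\<^sub>y X \<psi>) p = D\<^sub>y\<^sub>b (D\<^sub>y \<psi>) p + (D\<^sub>y\<^sub>b a p ** \<psi> p - \<psi> p ** D\<^sub>y\<^sub>b a p +
        (a p ** D\<^sub>y\<^sub>b \<psi> p - D\<^sub>y\<^sub>b \<psi> p ** a p))"
      unfolding AX\<^sub>y_def cov_y_def a_def[symmetric] unfolding D_eq_partial
      by (intro has_partial_imp_partial cov[unfolded D_eq_partial]
          D_commute_holomorphic[unfolded D_eq_partial, OF U] ha h\<psi> p) simp
    have 2: "D\<^sub>z (AX\<^sub>z X \<psi>) p = D\<^sub>z (D\<^sub>z \<psi>) p + (D\<^sub>z b p ** \<psi> p - \<psi> p ** D\<^sub>z b p +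
        (b p ** D\<^sub>z \<psi> p - D\<^sub>z \<psi> p ** b p))"
      unfolding AX\<^sub>z_def cov_z_def b_def[symmetric] unfolding D_eq_partial
      by (intro has_partial_imp_partial cov[unfolded D_eq_partial]
          D_commute_holomorphic[unfolded D_eq_partial, OF U] hb h\<psi> p) simp
    have "has_partial z_axis (D\<^sub>z \<psi>) (D\<^sub>z (D\<^sub>y \<phi>) p + (D\<^sub>z a p ** \<phi> p - \<phi> p ** D\<^sub>z a p +
        (a p ** D\<^sub>z \<phi> p - D\<^sub>z \<phi> p ** a p))) p"
      using cov[OF D_commute_holomorphic(4)[OF U \<phi>] ha \<phi> _ p, of z_axis]
      by (intro has_partial_cong[OF U _ p \<psi>z[symmetric]]) (simp_all add: D_eq_partial)
    then have 3: "D\<^sub>z (D\<^sub>z \<psi>) p = D\<^sub>z (D\<^sub>y \<phi>) p + (D\<^sub>z a p ** \<phi> p - \<phi> p ** D\<^sub>z a p +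
        (a p ** D\<^sub>z \<phi> p - D\<^sub>z \<phi> p ** a p))"
      unfolding D_eq_partial by (rule has_partial_imp_partial)
    \<comment> \<open>The second equation of the system is differentiated in \<open>y\<close>; fact
      4 then follows by commuting the derivatives of \<open>\<psi>\<close> and of
      \<open>\<phi>\<close>.\<close>
    have "has_partial y_axis (D\<^sub>y\<^sub>b \<psi>) (- (D\<^sub>y (D\<^sub>z \<phi>) p + (D\<^sub>y b p ** \<phi> p - \<phi> p ** D\<^sub>y b p +
        (b p ** D\<^sub>y \<phi> p - D\<^sub>y \<phi> p ** b p)))) p"
      using has_partial_minus[OF cov[OF D_commute_holomorphic(5)[OF U \<phi>] hb \<phi> _ p, of y_axis]]
      by (intro has_partial_cong[OF U _ p \<psi>b[symmetric]]) (simp_all add: D_eq_partial)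
    then have "D\<^sub>y (D\<^sub>y\<^sub>b \<psi>) p = - (D\<^sub>y (D\<^sub>z \<phi>) p + (D\<^sub>y b p ** \<phi> p - \<phi> p ** D\<^sub>y b p +
        (b p ** D\<^sub>y \<phi> p - D\<^sub>y \<phi> p ** b p)))"
      unfolding D_eq_partial by (rule has_partial_imp_partial)
    then have 4: "D\<^sub>y\<^sub>b (D\<^sub>y \<psi>) p = - (D\<^sub>z (D\<^sub>y \<phi>) p + (D\<^sub>y b p ** \<phi> p - \<phi> p ** D\<^sub>y b p +
        (b p ** D\<^sub>y \<phi> p - D\<^sub>y \<phi> p ** b p)))"
      by (simp only: D_commute_holomorphic(1)[OF U \<phi> p] D_commute_holomorphic(2)[OF U h\<psi> p])
    \<comment> \<open>Equality of mixed derivatives of \<open>X\<close>; it cancels the commutators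
      containing \<open>\<psi>\<close> undifferentiated.\<close>
    have 5: "D\<^sub>z b p = - D\<^sub>y\<^sub>b a p"
      using has_partial_imp_partial[OF b[OF _ p, of z_axis]] D_commute_holomorphic(3)[OF U hX p]
      by (simp add: D_eq_partial a_def)
    have "D\<^sub>y b p = - D\<^sub>y\<^sub>b (D\<^sub>y X) p"
      using has_partial_imp_partial[OF b[OF _ p, of y_axis]] D_commute_holomorphic(2)[OF U hX p]
      by (simp add: D_eq_partial)
    also have "\<dots> = D\<^sub>z a p - (a p ** b p - b p ** a p)"
    proof -
      have "D\<^sub>y\<^sub>b (D\<^sub>y X) p + D\<^sub>z a p + (a p ** (- b p) - (- b p) ** a p) = 0"
        using X p by (simp add: PSDYM3_solution_def commutator_def a_def b_def)
      then show ?thesis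
        by (simp add: matrix_ring_simps algebra_simps eq_neg_iff_add_eq_0 add_eq_0_iff)
    qed
    \<comment> \<open>This is the flatness of the connection, equivalent to the PSDYM3 equation for
      \<open>X\<close>.\<close>
    finally have 6: "D\<^sub>y b p = D\<^sub>z a p - (a p ** b p - b p ** a p)" .
    \<comment> \<open>After substitution the double commutators of \<open>a\<close>,
      \<open>b\<close> and \<open>\<phi>\<close> remain, and they cancel by the Jacobi
      identity.\<close>
    show ?thesis
      unfolding 1 2 3 4 5 6 \<psi>z[OF p] \<psi>b[OF p]
      by (simp add: commutator_def matrix_ring_simps algebra_simps)
  qed
  then show ?thesis using h\<psi> by (simp add: PSDYM3_characteristics_def)
qed

section \<open>Transport of characteristics between the two equations\<close>

lemma D_cong:
  assumes "open U" "p \<in> U" "\<And>q. q \<in> U \<Longrightarrow> f q = g q"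
  shows "D\<^sub>y f p = D\<^sub>y g p" "D\<^sub>z f p = D\<^sub>z g p" "D\<^sub>y\<^sub>b f p = D\<^sub>y\<^sub>b g p"
  using partial_cong[OF assms(1) _ assms(2,3)] by (simp_all add: D_eq_partial)

text \<open>Needed because \<open>J\<close> is known to be invertible only on \<open>U\<close>, so
  that multiplying by \<open>J\<close> and then by its inverse restores a field only there.\<close>

lemma PSDYM3_characteristics_cong:
  assumes U: "open U" and fg: "\<And>q. q \<in> U \<Longrightarrow> f q = g q" and f: "f \<in> PSDYM3_characteristics U X"
  shows "g \<in> PSDYM3_characteristics U X"
proof -
  have A: "AX\<^sub>y X f q = AX\<^sub>y X g q" "AX\<^sub>z X f q = AX\<^sub>z X g q" if "q \<in> U" for q
    using D_cong[OF U that fg] fg[OF that]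
    by (simp_all add: AX\<^sub>y_def AX\<^sub>z_def cov_y_def cov_z_def commutator_def)
  show ?thesis
    using f holomorphic_field_cong[OF U fg] D_cong[OF U _ A(1)] D_cong[OF U _ A(2)]
    by (simp add: PSDYM3_characteristics_def)
qed

lemma is_Rhat_recursion_operator:
  assumes "open U" "PSDYM3_solution U X" "is_Rhat U X R"
  shows "recursion_operator U (PSDYM3_characteristics U X) R"
  using assms common_solution_PSDYM3_characteristic[OF assms(1,2)]
  by (auto simp: recursion_operator_def is_Rhat_def PSDYM3_characteristics_def)

text \<open>On \<open>U\<close> the Backlund relations identify the potentials built from
  \<open>J\<close> with those built from \<open>X\<close>, so both sides impose the same equation on
  \<open>inv_mult J Q\<close>. Holomorphy passes in both directions because \<open>J\<close> and its
  inverse are holomorphic.\<close>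

lemma SDYM3_characteristic_iff:
  assumes U: "open U" and J: "SDYM3_solution U J" and B: "connected_by_Backlund U J X"
  shows "Q \<in> SDYM3_characteristics U J \<longleftrightarrow> inv_mult J Q \<in> PSDYM3_characteristics U X"
proof -
  have hJ: "holomorphic_field U J" and d: "\<And>p. p \<in> U \<Longrightarrow> det (J p) = 1"
    using J by (auto simp: SDYM3_solution_def)
  have inv: "J p ** inv_mult J Q p = Q p" if "p \<in> U" for p
    using matrix_inv_inverse(1)[of "J p"] d[OF that] by (simp add: inv_mult_def matrix_mul_assoc)
  have h: "holomorphic_field U Q \<longleftrightarrow> holomorphic_field U (inv_mult J Q)"
    using holomorphic_field_cong[OF U inv holomorphic_field_mult[OF U hJ]]
      holomorphic_field_mult[OF U holomorphic_field_matrix_inv[OF U hJ d]]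
    by (auto simp: inv_mult_def[abs_def])
  have A: "AX\<^sub>y X \<theta> p = AJ\<^sub>y J \<theta> p" "AX\<^sub>z X \<theta> p = AJ\<^sub>z J \<theta> p" if "p \<in> U" for \<theta> p
    using B that by (auto simp: AX\<^sub>y_def AX\<^sub>z_def AJ\<^sub>y_def AJ\<^sub>z_def cov_y_def cov_z_def
        commutator_def connected_by_Backlund_def)
  show ?thesis
    using D_cong[OF U _ A(1)] D_cong[OF U _ A(2)]
    by (simp add: SDYM3_characteristics_def PSDYM3_characteristics_def h)
qed

text \<open>Scalar matrices are central; this is what makes multiplication by \<open>J\<close> or
  its inverse linear in the sense of \<open>linear_operator_on\<close>.\<close>

lemma mat_mult_commute: "A ** mat c = mat c ** (A :: 'a::comm_ring_1^'n^'n)"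
  by (simp add: matrix_matrix_mult_def mat_def vec_eq_iff if_distrib if_distribR mult.commute cong: if_cong)

theorem proposition3:
  fixes U :: "point set"
    and J X :: "'n::finite mfield"
    and R :: "'n mfield \<Rightarrow> 'n mfield"
  assumes "open U"
    and "SDYM3_solution U J"
    and "PSDYM3_solution U X"
    and "connected_by_Backlund U J X"
    and "is_Rhat U X R"
  shows "I_equivalent U J X R R (That J R)"
proof -
  let ?V = "PSDYM3_characteristics U X" and ?W = "SDYM3_characteristics U J"
  have R: "recursion_operator U ?V R"
    using is_Rhat_recursion_operator assms by blast
  have R_cong: "R f p = R g p" if "f \<in> ?V" "g \<in> ?V" "\<And>q. q \<in> U \<Longrightarrow> f q = g q" "p \<in> U" for f g p
    using R that unfolding recursion_operator_def linear_operator_on_def by blast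
  have R_linear: "R (\<lambda>q. mat a ** f q + mat b ** g q) p = mat a ** R f p + mat b ** R g p"
    if "f \<in> ?V" "g \<in> ?V" "p \<in> U" for f g a b p
    using R that unfolding recursion_operator_def linear_operator_on_def by blast
  have R_closed: "R f \<in> ?V" if "f \<in> ?V" for f
    using R that unfolding recursion_operator_def by blast
  note char_iff = SDYM3_characteristic_iff[OF assms(1,2,4)]
  have inv: "inv_mult J (That J R Q) p = R (inv_mult J Q) p" if "p \<in> U" for Q p
    using assms(2) that matrix_inv_inverse(2)[of "J p"]
    by (simp add: inv_mult_def That_def SDYM3_solution_def matrix_mul_assoc)
  have inv_closed: "inv_mult J (That J R Q) \<in> ?V" if "Q \<in> ?W" for Q
    using PSDYM3_characteristics_cong[OF assms(1) inv[symmetric] R_closed] that char_iff by blast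
  \<comment> \<open>An equality of functions at all points, not only on \<open>U\<close>, so it can
    be rewritten inside the argument of \<open>R\<close>.\<close>
  have inv_linear: "inv_mult J (\<lambda>q. mat a ** f q + mat b ** g q) =
      (\<lambda>q. mat a ** inv_mult J f q + mat b ** inv_mult J g q)" for a b f g
    by (simp add: inv_mult_def matrix_add_ldistrib matrix_mul_assoc mat_mult_commute)
  have "recursion_operator U ?W (That J R)"
    unfolding recursion_operator_def linear_operator_on_def
  proof (intro conjI ballI allI impI)
    fix f g p assume fg: "f \<in> ?W" "g \<in> ?W" and p: "p \<in> U"
    show "That J R f p = That J R g p" if "\<forall>p\<in>U. f p = g p"
      using R_cong[of "inv_mult J f" "inv_mult J g" p] that p fg
      by (simp add: That_def char_iff inv_mult_def)
    show "That J R (\<lambda>q. mat a ** f q + mat b ** g q) p =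
        mat a ** That J R f p + mat b ** That J R g p" for a b
      using fg p by (simp add: That_def inv_linear R_linear char_iff matrix_add_ldistrib
          matrix_mul_assoc mat_mult_commute)
  next
    show "That J R f \<in> ?W" if "f \<in> ?W" for f
      using inv_closed[OF that] by (simp add: char_iff)
  qed
  \<comment> \<open>On \<open>U\<close> both \<open>\<Phi>\<close> and
    \<open>inv_mult J (That J R Q)\<close> equal \<open>R (inv_mult J Q)\<close>; as both are
    characteristics, \<open>R\<close> sends them to the same values there.\<close>
  moreover have "R \<Phi> p = I_map J R (That J R Q) p"
    if Q: "Q \<in> ?W" and "\<Phi> \<in> ?V" and \<Phi>: "\<forall>p\<in>U. \<Phi> p = I_map J R Q p" and "p \<in> U" for Q \<Phi> p
    unfolding I_map_def
    using that inv by (intro R_cong inv_closed) (simp_all add: I_map_def)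
  ultimately show ?thesis
    using R by (simp add: I_equivalent_def)
qed

end
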